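(* Let $\alpha\in\mathbb{R}$. Let $P_1$ and $P_2$ be two given (distinct) points contained in $\mathcal{C}^+$, and let $S_{12}$ be the segment joining $P_1$ and $P_2$. If $P_1$ and $P_2$ are collinear with $0=(0,0)$ and $0\notin S_{12}$, then the maximizer of the energy $E_\alpha$ among all spacelike curves joining $P_1$ and $P_2$ is the segment $S_{12}$; that is, $E_\alpha[\gamma]\le E_\alpha[S_{12}]$ for every such curve $\gamma$.
   Context: $\mathbb{L}^2=(\mathbb{R}^2,\langle\cdot,\cdot\rangle)$ with $\langle\cdot,\cdot\rangle=dx^2-dy^2$; $\mathcal{C}=\{p:\langle p,p\rangle=0\}$ is the lightlike cone and $\mathcal{C}^+=\{p\in\mathbb{L}^2:\langle p,p\rangle>0\}$. A smooth regular curve $\gamma\colon[a,b]\to\mathbb{L}^2$ is spacelike if $\langle\gamma',\gamma'\rangle>0$ everywhere. The curves considered do not intersect $\mathcal{C}$. The energy of a spacelike curve is $E_\alpha[\gamma]=\int_\gamma|\gamma|^\alpha\,ds$, where $|\gamma|^\alpha=|\langle\gamma,\gamma\rangle|^{\alpha/2}$ and $ds$ is the arc-length element; i.e. $E_\alpha[\gamma]=\int_a^b|\langle\gamma(t),\gamma(t)\rangle|^{\alpha/2}\sqrt{\langle\gamma'(t),\gamma'(t)\rangle}\,dt$. *)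

theory Defs
  imports "HOL-Analysis.Analysis"
begin

definition lorentz :: "real \<times> real \<Rightarrow> real \<times> real \<Rightarrow> real" where
  "lorentz p q = fst p * fst q - snd p * snd q"

definition light_cone :: "(real \<times> real) set" where
  "light_cone = {p. lorentz p p = 0}"

definition cone_plus :: "(real \<times> real) set" where
  "cone_plus = {p. lorentz p p > 0}"

text \<open>A curve on the compact interval from a to b is a function on all of the reals of which
  only the values on the interval matter. Smooth means infinitely differentiable on the
  closed interval, with one-sided derivatives at the endpoints; D k is the k-th derivative.\<close>

definition smooth_curve :: "real \<Rightarrow> real \<Rightarrow> (real \<Rightarrow> real \<times> real) \<Rightarrow> bool" where
  "smooth_curve a b \<gamma> \<longleftrightarrow> a < b \<and>
     (\<exists>D. D 0 = \<gamma> \<and>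
       (\<forall>k. \<forall>t\<in>{a..b}. (D k has_vector_derivative D (Suc k) t) (at t within {a..b})))"

definition velocity :: "real \<Rightarrow> real \<Rightarrow> (real \<Rightarrow> real \<times> real) \<Rightarrow> real \<Rightarrow> real \<times> real" where
  "velocity a b \<gamma> t = vector_derivative \<gamma> (at t within {a..b})"

definition regular_curve :: "real \<Rightarrow> real \<Rightarrow> (real \<Rightarrow> real \<times> real) \<Rightarrow> bool" where
  "regular_curve a b \<gamma> \<longleftrightarrow> smooth_curve a b \<gamma> \<and> (\<forall>t\<in>{a..b}. velocity a b \<gamma> t \<noteq> 0)"

definition spacelike_curve :: "real \<Rightarrow> real \<Rightarrow> (real \<Rightarrow> real \<times> real) \<Rightarrow> bool" where
  "spacelike_curve a b \<gamma> \<longleftrightarrow> regular_curve a b \<gamma> \<and>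
     (\<forall>t\<in>{a..b}. lorentz (velocity a b \<gamma> t) (velocity a b \<gamma> t) > 0)"

text \<open>The competitors: spacelike curves from P to Q that avoid the lightlike cone.\<close>

definition spacelike_joining ::
    "real \<times> real \<Rightarrow> real \<times> real \<Rightarrow> real \<Rightarrow> real \<Rightarrow> (real \<Rightarrow> real \<times> real) \<Rightarrow> bool" where
  "spacelike_joining P Q a b \<gamma> \<longleftrightarrow> spacelike_curve a b \<gamma> \<and>
     \<gamma> ` {a..b} \<inter> light_cone = {} \<and> \<gamma> a = P \<and> \<gamma> b = Q"

text \<open>The convention that 0 powr x is 0 is never met on a curve that avoids the lightlike
  cone; there the integrand is continuous, so the integral exists.\<close>

definition energy :: "real \<Rightarrow> real \<Rightarrow> real \<Rightarrow> (real \<Rightarrow> real \<times> real) \<Rightarrow> real" where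
  "energy \<alpha> a b \<gamma> = integral {a..b} (\<lambda>t.
     \<bar>lorentz (\<gamma> t) (\<gamma> t)\<bar> powr (\<alpha> / 2) *
     sqrt (lorentz (velocity a b \<gamma> t) (velocity a b \<gamma> t)))"

end

theory Submission imports Defs begin

text \<open>The argument is a calibration by the Lorentzian distance to the origin,
  \<open>r = sqrt \<langle>\<gamma>, \<gamma>\<rangle>\<close>. A competitor starts where \<open>\<langle>\<gamma>, \<gamma>\<rangle>\<close> is positive and avoids the cone, so
  \<open>r > 0\<close> along all of it. In signature \<open>(1, 1)\<close> the orthogonal complement of a spacelike vector
  is timelike, so the component of \<open>\<gamma>'\<close> orthogonal to \<open>\<gamma>\<close> shortens \<open>\<gamma>'\<close>: the reversed
  Cauchy-Schwarz inequality \<open>\<langle>\<gamma>, \<gamma>\<rangle> \<langle>\<gamma>', \<gamma>'\<rangle> \<le> \<langle>\<gamma>, \<gamma>'\<rangle>\<^sup>2\<close> (\<open>lorentz_reversed_Cauchy_Schwarz\<close>) says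
  exactly \<open>sqrt \<langle>\<gamma>', \<gamma>'\<rangle> \<le> \<bar>r'\<bar>\<close>.

  For a spacelike \<open>\<gamma>'\<close> the same inequality makes \<open>\<langle>\<gamma>, \<gamma>'\<rangle>\<close>, hence \<open>r'\<close>, nowhere zero, so \<open>r\<close> is
  strictly monotone and \<open>\<integral> r powr \<alpha> * \<bar>r'\<bar>\<close> depends on the endpoints only: it is
  \<open>\<bar>F (r b) - F (r a)\<bar>\<close> for a primitive \<open>F\<close> of \<open>x powr \<alpha>\<close> (\<open>radial_energy_has_integral\<close>). This
  number bounds the energy of every competitor. On a segment of a line through the origin \<open>\<gamma>'\<close>
  is proportional to \<open>\<gamma>\<close>, the inequality becomes an equality, and the bound is attained.\<close>

section \<open>The Lorentzian product\<close>

lemma lorentz_scaleR: "lorentz (c *\<^sub>R p) (d *\<^sub>R q) = c * d * lorentz p q"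
  by (simp add: lorentz_def algebra_simps)

text \<open>The defect \<open>\<langle>p, q\<rangle>\<^sup>2 - \<langle>p, p\<rangle> \<langle>q, q\<rangle>\<close> is the square of the determinant of \<open>p\<close> and \<open>q\<close>.\<close>

lemma lorentz_reversed_Cauchy_Schwarz: "lorentz p p * lorentz q q \<le> (lorentz p q)\<^sup>2"
proof -
  have "(lorentz p q)\<^sup>2 - lorentz p p * lorentz q q = (fst p * snd q - snd p * fst q)\<^sup>2"
    by (simp add: lorentz_def power2_eq_square algebra_simps)
  then show ?thesis
    by (metis diff_ge_0_iff_ge zero_le_power2)
qed

lemma sqrt_lorentz_le_radial:
  assumes "lorentz p p > 0"
  shows "sqrt (lorentz q q) \<le> \<bar>lorentz p q\<bar> / sqrt (lorentz p p)"
proof -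
  have "sqrt (lorentz p p) * sqrt (lorentz q q) \<le> \<bar>lorentz p q\<bar>"
    using lorentz_reversed_Cauchy_Schwarz[of p q]
    by (metis real_sqrt_abs real_sqrt_le_mono real_sqrt_mult)
  then show ?thesis
    using assms by (simp add: pos_le_divide_eq mult.commute)
qed

lemma continuous_on_lorentz [continuous_intros]:
  assumes "continuous_on S f" "continuous_on S g"
  shows "continuous_on S (\<lambda>t. lorentz (f t) (g t))"
  unfolding lorentz_def using assms by (intro continuous_intros)

lemma has_real_derivative_lorentz_self:
  assumes "(\<gamma> has_vector_derivative v) (at t within S)"
  shows "((\<lambda>t. lorentz (\<gamma> t) (\<gamma> t)) has_real_derivative 2 * lorentz (\<gamma> t) v) (at t within S)"
proof -
  have "((\<lambda>t. fst (\<gamma> t)) has_real_derivative fst v) (at t within S)"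
    "((\<lambda>t. snd (\<gamma> t)) has_real_derivative snd v) (at t within S)"
    using bounded_linear.has_vector_derivative[OF bounded_linear_fst assms]
      bounded_linear.has_vector_derivative[OF bounded_linear_snd assms]
    by (simp_all add: has_real_derivative_iff_has_vector_derivative)
  then show ?thesis
    unfolding lorentz_def by (auto intro!: derivative_eq_intros)
qed

section \<open>The energy of the radial motion\<close>

definition powr_primitive :: "real \<Rightarrow> real \<Rightarrow> real" where
  "powr_primitive \<alpha> x = (if \<alpha> = -1 then ln x else x powr (\<alpha> + 1) / (\<alpha> + 1))"

lemma has_real_derivative_powr_primitive:
  assumes "x > 0"
  shows "(powr_primitive \<alpha> has_real_derivative x powr \<alpha>) (at x)"
proof (cases "\<alpha> = -1")
  case True
  then have "powr_primitive \<alpha> = ln"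
    by (auto simp: powr_primitive_def)
  then show ?thesis
    using assms True by (auto intro!: derivative_eq_intros simp: powr_minus divide_simps)
next
  case False
  then have "powr_primitive \<alpha> = (\<lambda>x. x powr (\<alpha> + 1) / (\<alpha> + 1))"
    by (auto simp: powr_primitive_def)
  moreover have "\<alpha> + 1 \<noteq> 0"
    using False by linarith
  ultimately show ?thesis
    using assms by (auto intro!: derivative_eq_intros)
qed

text \<open>The integrand is \<open>r powr \<alpha> * r'\<close> with \<open>r = sqrt \<langle>\<gamma>, \<gamma>\<rangle>\<close>.\<close>

lemma radial_has_integral:
  assumes "a \<le> b"
    and deriv: "\<And>t. t \<in> {a..b} \<Longrightarrow> (\<gamma> has_vector_derivative \<gamma>' t) (at t within {a..b})"
    and pos: "\<And>t. t \<in> {a..b} \<Longrightarrow> lorentz (\<gamma> t) (\<gamma> t) > 0"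
  shows "((\<lambda>t. lorentz (\<gamma> t) (\<gamma> t) powr (\<alpha> / 2) *
            (lorentz (\<gamma> t) (\<gamma>' t) / sqrt (lorentz (\<gamma> t) (\<gamma> t)))) has_integral
          powr_primitive \<alpha> (sqrt (lorentz (\<gamma> b) (\<gamma> b))) -
          powr_primitive \<alpha> (sqrt (lorentz (\<gamma> a) (\<gamma> a)))) {a..b}"
proof (rule fundamental_theorem_of_calculus[OF assms(1)])
  fix t assume t: "t \<in> {a..b}"
  let ?q = "\<lambda>t. lorentz (\<gamma> t) (\<gamma> t)"
  have "((\<lambda>t. sqrt (?q t)) has_real_derivative
      inverse (sqrt (?q t)) / 2 * (2 * lorentz (\<gamma> t) (\<gamma>' t))) (at t within {a..b})"
    by (rule DERIV_chain2[OF DERIV_real_sqrt[OF pos[OF t]]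
          has_real_derivative_lorentz_self[OF deriv[OF t]]])
  from DERIV_chain2[OF has_real_derivative_powr_primitive this, of \<alpha>]
  have "((\<lambda>t. powr_primitive \<alpha> (sqrt (?q t))) has_real_derivative
      sqrt (?q t) powr \<alpha> * (inverse (sqrt (?q t)) / 2 * (2 * lorentz (\<gamma> t) (\<gamma>' t))))
      (at t within {a..b})"
    using pos[OF t] by simp
  moreover have "sqrt (?q t) powr \<alpha> = ?q t powr (\<alpha> / 2)"
    using pos[OF t] by (simp add: powr_half_sqrt[symmetric] powr_powr)
  ultimately show "((\<lambda>t. powr_primitive \<alpha> (sqrt (?q t))) has_vector_derivative
      ?q t powr (\<alpha> / 2) * (lorentz (\<gamma> t) (\<gamma>' t) / sqrt (?q t))) (at t within {a..b})"
    by (simp add: has_real_derivative_iff_has_vector_derivative field_simps)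
qed

lemma nonvanishing_imp_constant_sign:
  fixes w :: "real \<Rightarrow> real"
  assumes "continuous_on {a..b} w" and "\<And>t. t \<in> {a..b} \<Longrightarrow> w t \<noteq> 0"
  shows "(\<forall>t\<in>{a..b}. w t > 0) \<or> (\<forall>t\<in>{a..b}. w t < 0)"
proof (rule ccontr)
  assume "\<not> ?thesis"
  then obtain s t where "s \<in> {a..b}" "t \<in> {a..b}" "w s \<le> 0" "w t \<ge> 0"
    by (meson not_less)
  then have "0 \<in> w ` {a..b}"
    using connectedD_interval[OF connected_continuous_image[OF assms(1) connected_Icc]] by blast
  then show False
    using assms(2) by auto
qed

text \<open>A nonvanishing \<open>\<langle>\<gamma>, \<gamma>'\<rangle>\<close> makes the radius monotone, so that the radial motion never
  retraces its way and its energy is the total change of the primitive.\<close>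

lemma radial_energy_has_integral:
  assumes "a \<le> b"
    and deriv: "\<And>t. t \<in> {a..b} \<Longrightarrow> (\<gamma> has_vector_derivative \<gamma>' t) (at t within {a..b})"
    and cont: "continuous_on {a..b} \<gamma>'"
    and pos: "\<And>t. t \<in> {a..b} \<Longrightarrow> lorentz (\<gamma> t) (\<gamma> t) > 0"
    and nonzero: "\<And>t. t \<in> {a..b} \<Longrightarrow> lorentz (\<gamma> t) (\<gamma>' t) \<noteq> 0"
  shows "((\<lambda>t. lorentz (\<gamma> t) (\<gamma> t) powr (\<alpha> / 2) *
            (\<bar>lorentz (\<gamma> t) (\<gamma>' t)\<bar> / sqrt (lorentz (\<gamma> t) (\<gamma> t)))) has_integral
          \<bar>powr_primitive \<alpha> (sqrt (lorentz (\<gamma> b) (\<gamma> b))) -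
           powr_primitive \<alpha> (sqrt (lorentz (\<gamma> a) (\<gamma> a)))\<bar>) {a..b}"
    (is "(?f has_integral \<bar>?\<Delta>\<bar>) _")
proof -
  have "continuous_on {a..b} \<gamma>"
    by (rule continuous_on_vector_derivative[OF deriv])
  then have "continuous_on {a..b} (\<lambda>t. lorentz (\<gamma> t) (\<gamma>' t))"
    using cont by (intro continuous_intros)
  then have "(\<forall>t\<in>{a..b}. lorentz (\<gamma> t) (\<gamma>' t) > 0) \<or> (\<forall>t\<in>{a..b}. lorentz (\<gamma> t) (\<gamma>' t) < 0)"
    by (rule nonvanishing_imp_constant_sign[OF _ nonzero])
  then obtain s :: real where s: "s = 1 \<or> s = -1"
    and abs_eq: "\<And>t. t \<in> {a..b} \<Longrightarrow> \<bar>lorentz (\<gamma> t) (\<gamma>' t)\<bar> = s * lorentz (\<gamma> t) (\<gamma>' t)"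
  proof (elim disjE)
    assume "\<forall>t\<in>{a..b}. lorentz (\<gamma> t) (\<gamma>' t) > 0"
    then show thesis
      by (intro that[of 1]) (auto simp: abs_of_pos)
  next
    assume "\<forall>t\<in>{a..b}. lorentz (\<gamma> t) (\<gamma>' t) < 0"
    then show thesis
      by (intro that[of "-1"]) (auto simp: abs_of_neg)
  qed
  have integral: "(?f has_integral s * ?\<Delta>) {a..b}"
    by (rule has_integral_eq[OF _
          has_integral_mult_right[OF radial_has_integral[OF assms(1) deriv pos]]])
      (auto simp: abs_eq)
  \<comment> \<open>The sign is the right one because the integrand is nonnegative.\<close>
  have "0 \<le> s * ?\<Delta>"
    by (rule has_integral_nonneg[OF integral]) (simp add: less_imp_le[OF pos])
  then have "s * ?\<Delta> = \<bar>?\<Delta>\<bar>"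
    using s by auto
  then show ?thesis
    using integral by simp
qed

section \<open>Spacelike curves\<close>

lemma spacelike_curve_velocity:
  assumes "spacelike_curve a b \<gamma>"
  shows "a < b"
    and "\<And>t. t \<in> {a..b} \<Longrightarrow> (\<gamma> has_vector_derivative velocity a b \<gamma> t) (at t within {a..b})"
    and "continuous_on {a..b} (velocity a b \<gamma>)"
proof -
  obtain D where ab: "a < b" and D0: "D 0 = \<gamma>"
    and D: "\<And>k t. t \<in> {a..b} \<Longrightarrow> (D k has_vector_derivative D (Suc k) t) (at t within {a..b})"
    using assms unfolding spacelike_curve_def regular_curve_def smooth_curve_def by blast
  show "a < b"
    by fact
  have eq: "velocity a b \<gamma> t = D 1 t" if "t \<in> {a..b}" for t
    unfolding velocity_def
    using D[OF that, of 0] D0 ab that by (simp add: vector_derivative_within_closed_interval)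
  show "(\<gamma> has_vector_derivative velocity a b \<gamma> t) (at t within {a..b})" if "t \<in> {a..b}" for t
    using D[OF that, of 0] D0 eq[OF that] by simp
  have "continuous_on {a..b} (D 1)"
    by (rule continuous_on_vector_derivative[OF D])
  then show "continuous_on {a..b} (velocity a b \<gamma>)"
    by (rule continuous_on_eq) (simp add: eq)
qed

text \<open>Positivity propagates from the starting point by connectedness, since \<open>\<langle>\<gamma>, \<gamma>\<rangle>\<close> cannot
  change sign without vanishing.\<close>

lemma spacelike_joining_in_cone_plus:
  assumes "spacelike_joining P Q a b \<gamma>" and "P \<in> cone_plus" and "t \<in> {a..b}"
  shows "lorentz (\<gamma> t) (\<gamma> t) > 0"
proof -
  have spacelike: "spacelike_curve a b \<gamma>" and "\<gamma> a = P"
    and avoid: "\<gamma> ` {a..b} \<inter> light_cone = {}"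
    using assms(1) by (simp_all add: spacelike_joining_def)
  then have start: "lorentz (\<gamma> a) (\<gamma> a) > 0"
    using assms(2) by (simp add: cone_plus_def)
  have nonzero: "lorentz (\<gamma> t) (\<gamma> t) \<noteq> 0" if "t \<in> {a..b}" for t
  proof -
    have "\<gamma> t \<notin> light_cone"
      using avoid that by blast
    then show ?thesis
      by (simp add: light_cone_def)
  qed
  have "continuous_on {a..b} \<gamma>"
    by (rule continuous_on_vector_derivative[OF spacelike_curve_velocity(2)[OF spacelike]])
  then have "continuous_on {a..b} (\<lambda>t. lorentz (\<gamma> t) (\<gamma> t))"
    by (intro continuous_intros)
  then have "(\<forall>t\<in>{a..b}. lorentz (\<gamma> t) (\<gamma> t) > 0) \<or> (\<forall>t\<in>{a..b}. lorentz (\<gamma> t) (\<gamma> t) < 0)"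
    by (rule nonvanishing_imp_constant_sign[OF _ nonzero])
  moreover have "a \<in> {a..b}"
    using assms(3) by auto
  ultimately show ?thesis
    using start assms(3) by fastforce
qed

text \<open>Integrating \<open>sqrt \<langle>\<gamma>', \<gamma>'\<rangle> \<le> \<bar>r'\<bar>\<close> against \<open>r powr \<alpha>\<close> gives a bound by data of the endpoints;
  equality in the reversed Cauchy-Schwarz inequality all along the curve passes to the integral.\<close>

lemma
  assumes joining: "spacelike_joining P Q a b \<gamma>" and P: "P \<in> cone_plus"
  shows energy_le_radial:
      "energy \<alpha> a b \<gamma> \<le> \<bar>powr_primitive \<alpha> (sqrt (lorentz Q Q)) -
        powr_primitive \<alpha> (sqrt (lorentz P P))\<bar>" (is "_ \<le> ?R")
    and energy_eq_radial:
      "(\<And>t. t \<in> {a..b} \<Longrightarrow> lorentz (\<gamma> t) (\<gamma> t) *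
          lorentz (velocity a b \<gamma> t) (velocity a b \<gamma> t) = (lorentz (\<gamma> t) (velocity a b \<gamma> t))\<^sup>2) \<Longrightarrow>
       energy \<alpha> a b \<gamma> = \<bar>powr_primitive \<alpha> (sqrt (lorentz Q Q)) -
        powr_primitive \<alpha> (sqrt (lorentz P P))\<bar>"
proof -
  let ?v = "velocity a b \<gamma>"
  let ?q = "\<lambda>t. lorentz (\<gamma> t) (\<gamma> t)"
  let ?e = "\<lambda>t. \<bar>?q t\<bar> powr (\<alpha> / 2) * sqrt (lorentz (?v t) (?v t))"
  let ?r = "\<lambda>t. ?q t powr (\<alpha> / 2) * (\<bar>lorentz (\<gamma> t) (?v t)\<bar> / sqrt (?q t))"
  have spacelike: "spacelike_curve a b \<gamma>" and ends: "\<gamma> a = P" "\<gamma> b = Q"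
    using joining by (auto simp: spacelike_joining_def)
  note velocity = spacelike_curve_velocity[OF spacelike]
  note pos = spacelike_joining_in_cone_plus[OF joining P]
  have velocity_pos: "lorentz (?v t) (?v t) > 0" if "t \<in> {a..b}" for t
    using spacelike that by (simp add: spacelike_curve_def)
  have nonzero: "lorentz (\<gamma> t) (?v t) \<noteq> 0" if "t \<in> {a..b}" for t
    using lorentz_reversed_Cauchy_Schwarz[of "\<gamma> t" "?v t"]
      mult_pos_pos[OF pos[OF that] velocity_pos[OF that]] by auto
  have radial: "(?r has_integral ?R) {a..b}"
    using radial_energy_has_integral[OF less_imp_le[OF velocity(1)] velocity(2,3) pos nonzero] ends
    by simp
  have "continuous_on {a..b} \<gamma>"
    by (rule continuous_on_vector_derivative[OF velocity(2)])
  then have "continuous_on {a..b} ?e"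
    using velocity(3) by (intro continuous_intros) (use pos in force)+
  then have "(?e has_integral energy \<alpha> a b \<gamma>) {a..b}"
    unfolding energy_def by (intro integrable_integral integrable_continuous_interval)
  then show "energy \<alpha> a b \<gamma> \<le> ?R"
  proof (rule has_integral_le[OF _ radial])
    fix t assume t: "t \<in> {a..b}"
    show "?e t \<le> ?r t"
      using pos[OF t] sqrt_lorentz_le_radial[OF pos[OF t], of "?v t"]
      by (simp del: times_divide_eq_right add: mult_left_mono)
  qed
  show "energy \<alpha> a b \<gamma> = ?R"
    if parallel: "\<And>t. t \<in> {a..b} \<Longrightarrow> ?q t * lorentz (?v t) (?v t) = (lorentz (\<gamma> t) (?v t))\<^sup>2"
    unfolding energy_def
  proof (rule integral_unique, rule has_integral_eq[OF _ radial])
    fix t assume t: "t \<in> {a..b}"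
    have "\<bar>lorentz (\<gamma> t) (?v t)\<bar> = sqrt (?q t) * sqrt (lorentz (?v t) (?v t))"
      using parallel[OF t] by (metis real_sqrt_abs real_sqrt_mult)
    then show "?r t = ?e t"
      using pos[OF t] by simp
  qed
qed

section \<open>Segments on a line through the origin\<close>

lemma collinear_same_side:
  fixes P Q :: "'a::real_vector"
  assumes "collinear {0, P, Q}" and "0 \<notin> closed_segment P Q"
  obtains c where "c > 0" and "Q = c *\<^sub>R P"
proof -
  have "P \<noteq> 0" "Q \<noteq> 0"
    using assms(2) by auto
  then obtain c where c: "Q = c *\<^sub>R P"
    using assms(1) unfolding collinear_lemma by blast
  have "c > 0"
  proof (rule ccontr)
    assume "\<not> c > 0"
    \<comment> \<open>The segment passes through the origin at the parameter \<open>1 / (1 - c)\<close>.\<close>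
    then have "0 \<le> 1 / (1 - c)" "1 / (1 - c) \<le> 1" "(1 - 1 / (1 - c)) + 1 / (1 - c) * c = 0"
      by (auto simp: field_simps)
    moreover from this(3) have "0 = (1 - 1 / (1 - c)) *\<^sub>R P + (1 / (1 - c)) *\<^sub>R Q"
      unfolding c scaleR_scaleR scaleR_add_left[symmetric] by simp
    ultimately show False
      using assms(2) unfolding in_segment by blast
  qed
  then show ?thesis
    using that c by blast
qed

lemma velocity_linepath:
  assumes "a < b" and "t \<in> {a..b}"
  shows "velocity a b (linepath P Q) t = Q - P"
  unfolding velocity_def
  using assms by (intro vector_derivative_within_closed_interval)
    (auto intro: has_vector_derivative_linepath_within)

lemma smooth_curve_linepath:
  assumes "a < b"
  shows "smooth_curve a b (linepath P Q)"
proof -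
  let ?D = "\<lambda>k::nat. if k = 0 then linepath P Q else if k = 1 then (\<lambda>t. Q - P) else (\<lambda>t. 0)"
  have "\<forall>k. \<forall>t\<in>{a..b}. (?D k has_vector_derivative ?D (Suc k) t) (at t within {a..b})"
    by (auto intro: has_vector_derivative_linepath_within)
  then show ?thesis
    unfolding smooth_curve_def using assms by (intro conjI exI[of _ ?D]) auto
qed

theorem theorem5p1:
  fixes \<alpha> :: real and P1 P2 :: "real \<times> real"
  assumes "P1 \<noteq> P2"
    and "P1 \<in> cone_plus" and "P2 \<in> cone_plus"
    and "collinear {0, P1, P2}"
    and "0 \<notin> closed_segment P1 P2"
  shows "spacelike_joining P1 P2 0 1 (linepath P1 P2) \<and>
    (\<forall>a b \<gamma>. spacelike_joining P1 P2 a b \<gamma> \<longrightarrow>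
       energy \<alpha> a b \<gamma> \<le> energy \<alpha> 0 1 (linepath P1 P2))"
proof -
  let ?\<sigma> = "linepath P1 P2"
  obtain c where c: "c > 0" and P2: "P2 = c *\<^sub>R P1"
    using collinear_same_side[OF assms(4,5)] .
  have c1: "c - 1 \<noteq> 0"
    using assms(1) P2 by auto
  have P1_pos: "lorentz P1 P1 > 0"
    using assms(2) by (simp add: cone_plus_def)
  have position: "?\<sigma> t = ((1 - t) + t * c) *\<^sub>R P1" for t
    by (simp add: linepath_def P2 scaleR_add_left)
  have velocity: "velocity 0 1 ?\<sigma> t = (c - 1) *\<^sub>R P1" if "t \<in> {0..1}" for t
    using velocity_linepath[of 0 1 t P1 P2] that by (simp add: P2 scaleR_diff_left)
  have "?\<sigma> t \<notin> light_cone" if "t \<in> {0..1}" for t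
  proof -
    have "(1 - t) + t * c > 0"
      using that c by (cases "t = 0") (auto intro: add_nonneg_pos)
    then show ?thesis
      using P1_pos by (simp add: position light_cone_def lorentz_scaleR)
  qed
  moreover have velocity_pos: "lorentz (velocity 0 1 ?\<sigma> t) (velocity 0 1 ?\<sigma> t) > 0"
    if "t \<in> {0..1}" for t
    unfolding velocity[OF that] lorentz_scaleR
    using c1 P1_pos by (metis mult_pos_pos not_real_square_gt_zero)
  moreover have "velocity 0 1 ?\<sigma> t \<noteq> 0" if "t \<in> {0..1}" for t
    using velocity_pos[OF that] by (auto simp: lorentz_def)
  ultimately have segment: "spacelike_joining P1 P2 0 1 ?\<sigma>"
    unfolding spacelike_joining_def spacelike_curve_def regular_curve_def
    by (auto simp: smooth_curve_linepath linepath_0' linepath_1')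
  \<comment> \<open>Position and velocity of the segment are both multiples of \<open>P1\<close>.\<close>
  have "energy \<alpha> 0 1 ?\<sigma> = \<bar>powr_primitive \<alpha> (sqrt (lorentz P2 P2)) -
      powr_primitive \<alpha> (sqrt (lorentz P1 P1))\<bar>"
    by (rule energy_eq_radial[OF segment assms(2)])
      (simp add: position velocity lorentz_scaleR power2_eq_square)
  then show ?thesis
    using segment energy_le_radial[OF _ assms(2)] by simp
qed

end
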